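(* For every $\phi\in\mathcal{G}_0(\mathbb{C}[[x,t]])$ there exists a unique $D\in\mathrm{Der}_0(\mathbb{C}[[x,t]])$ such that $\phi=\chi_D$.
   Context: Let $\rho:\mathbb{C}[[x,t]]\to\mathbb{C}[[x]]$ be the $\mathbb{C}$-algebra morphism defined by setting $t=0$. Let $\mathcal{G}(\mathbb{C}[[x,t]])$ be the group of automorphisms $\phi$ of the $\mathbb{C}$-algebra $\mathbb{C}[[x,t]]$ such that $\rho\circ\phi=\rho$. For such a $\phi$ one has $\phi(t)=\nu t$ for a unique invertible $\nu\in\mathbb{C}[[x,t]]$, and $\phi\mapsto\nu(x,0)$ is a surjective group morphism $\mathcal{G}(\mathbb{C}[[x,t]])\to\mathbb{C}[[x]]^*$. Its kernel is denoted $\mathcal{G}_0(\mathbb{C}[[x,t]])$. $\mathrm{Der}_0(\mathbb{C}[[x,t]])$ denotes the vector space of derivations $D:\mathbb{C}[[x,t]]\to\mathbb{C}[[x,t]]$ such that $D(\mathbb{C}[[x,t]])\subset(t)$ and $D((t))\subset(t^2)$. These are exactly the derivations of the form $D=at\frac{\partial}{\partial x}+bt^2\frac{\partial}{\partial t}$ with $a,b\in\mathbb{C}[[x,t]]$. For such a $D$ one sets $$\chi_D=\sum_{k\geq 0}\frac{1}{k!}D^k:\mathbb{C}[[x,t]]\to\mathbb{C}[[x,t]],$$ which makes sense since $D^k$ has image in $(t^k)$ for every $k\ge 0$; it is an element of $\mathcal{G}_0(\mathbb{C}[[x,t]])$. *)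

theory Defs
  imports "HOL-Computational_Algebra.Formal_Power_Series"
begin

text \<open>
  The ring of power series in two variables over the complex numbers is encoded as
  \<open>complex fps fps\<close>: the inner series are in \<open>x\<close>, the outer ones in \<open>t\<close>.
\<close>

type_synonym fps_x = "complex fps"
type_synonym fps_xt = "complex fps fps"

definition scalar :: "complex \<Rightarrow> fps_xt" where
  "scalar c = fps_const (fps_const c)"

definition var_t :: fps_xt where
  "var_t = fps_X"

definition rho :: "fps_xt \<Rightarrow> fps_x" where
  "rho f = fps_nth f 0"

definition principal_ideal :: "fps_xt \<Rightarrow> fps_xt set" where
  "principal_ideal g = {f. g dvd f}"

definition algebra_automorphism :: "(fps_xt \<Rightarrow> fps_xt) \<Rightarrow> bool" where
  "algebra_automorphism \<phi> \<longleftrightarrow>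
     bij \<phi> \<and>
     (\<forall>f g. \<phi> (f + g) = \<phi> f + \<phi> g) \<and>
     (\<forall>f g. \<phi> (f * g) = \<phi> f * \<phi> g) \<and>
     (\<forall>c. \<phi> (scalar c) = scalar c)"

definition G :: "(fps_xt \<Rightarrow> fps_xt) set" where
  "G = {\<phi>. algebra_automorphism \<phi> \<and> rho \<circ> \<phi> = rho}"

definition nu :: "(fps_xt \<Rightarrow> fps_xt) \<Rightarrow> fps_xt" where
  "nu \<phi> = (THE \<nu>. \<nu> dvd 1 \<and> \<phi> var_t = \<nu> * var_t)"

definition G0 :: "(fps_xt \<Rightarrow> fps_xt) set" where
  "G0 = {\<phi> \<in> G. rho (nu \<phi>) = 1}"

definition derivation :: "(fps_xt \<Rightarrow> fps_xt) \<Rightarrow> bool" where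
  "derivation D \<longleftrightarrow>
     (\<forall>f g. D (f + g) = D f + D g) \<and>
     (\<forall>c f. D (scalar c * f) = scalar c * D f) \<and>
     (\<forall>f g. D (f * g) = f * D g + D f * g)"

definition Der0 :: "(fps_xt \<Rightarrow> fps_xt) set" where
  "Der0 = {D. derivation D \<and>
     D ` UNIV \<subseteq> principal_ideal var_t \<and>
     D ` principal_ideal var_t \<subseteq> principal_ideal (var_t ^ 2)}"

text \<open>
  The infinite sum refers to the library topology on \<open>complex fps fps\<close>, whose distance only
  depends on the order of vanishing in the outer variable; it is thus the \<open>t\<close>-adic topology.
\<close>

definition chi :: "(fps_xt \<Rightarrow> fps_xt) \<Rightarrow> fps_xt \<Rightarrow> fps_xt" where
  "chi D f = (\<Sum>k. scalar (1 / fact k) * (D ^^ k) f)"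

text \<open>Well-definedness of \<^const>\<open>nu\<close> and \<^const>\<open>chi\<close>.\<close>

lemma rho_eq_0_iff: "rho f = 0 \<longleftrightarrow> var_t dvd f"
proof
  assume "rho f = 0"
  then have "f = var_t * fps_shift 1 f"
    unfolding rho_def var_t_def
    by (intro fps_ext) (auto simp: fps_X_mult_nth)
  then show "var_t dvd f" by (rule dvdI)
qed (auto simp: rho_def var_t_def)

lemma rho_var_t: "rho var_t = 0"
  by (simp add: rho_def var_t_def)

lemma G_var_t:
  assumes "algebra_automorphism \<phi>" "rho \<circ> \<phi> = rho"
  shows "\<exists>\<nu>. \<phi> var_t = \<nu> * var_t"
proof -
  have "rho (\<phi> var_t) = rho var_t"
    using assms(2) by (metis comp_apply)
  then have "var_t dvd \<phi> var_t"
    by (simp add: rho_var_t flip: rho_eq_0_iff)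
  then show ?thesis by (auto simp: dvd_def mult.commute)
qed

lemma nu_ex1:
  assumes "\<phi> \<in> G"
  shows "\<exists>!\<nu>. \<nu> dvd 1 \<and> \<phi> var_t = \<nu> * var_t"
proof -
  have aut: "algebra_automorphism \<phi>" and rho: "rho \<circ> \<phi> = rho"
    using assms by (auto simp: G_def)
  then have mult: "\<phi> (f * g) = \<phi> f * \<phi> g" and bij: "bij \<phi>" for f g
    by (auto simp: algebra_automorphism_def)
  have nz: "var_t \<noteq> 0" by (simp add: var_t_def)
  obtain \<nu> where \<nu>: "\<phi> var_t = \<nu> * var_t"
    using G_var_t aut rho by blast
  obtain s where s: "\<phi> s = var_t"
    using bij by (metis bij_pointE)
  have "rho s = rho var_t"
    using rho s by (metis comp_apply)
  then have "var_t dvd s" by (simp add: rho_var_t flip: rho_eq_0_iff)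
  then obtain \<mu> where "s = \<mu> * var_t" by (auto simp: dvd_def mult.commute)
  then have "var_t * (\<nu> * \<phi> \<mu>) = var_t * 1"
    using s mult \<nu> by (simp add: algebra_simps)
  then have "\<nu> * \<phi> \<mu> = 1"
    using nz by (metis mult_cancel_left)
  then have "\<nu> dvd 1" by (metis dvdI)
  with \<nu> nz show ?thesis by auto
qed

lemma Der0_power:
  assumes "D \<in> Der0"
  shows "var_t ^ k dvd (D ^^ k) f"
proof -
  have ring: "D (f * g) = f * D g + D f * g"
    and D1: "var_t dvd D f"
    and D2: "var_t dvd f \<Longrightarrow> var_t\<^sup>2 dvd D f" for f g
    using assms unfolding Der0_def derivation_def principal_ideal_def by blast+
  have step: "var_t ^ Suc n dvd D (var_t ^ n * g)" for n g
  proof (induction n arbitrary: g)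
    case (Suc n)
    have "D (var_t ^ Suc n * g) = var_t * D (var_t ^ n * g) + D var_t * (var_t ^ n * g)"
      using ring[of var_t "var_t ^ n * g"] by (simp add: mult.assoc)
    moreover have "var_t ^ Suc (Suc n) dvd var_t * D (var_t ^ n * g)"
      using Suc[of g] by (subst power_Suc) (rule mult_dvd_mono, auto)
    moreover have "var_t ^ Suc (Suc n) dvd D var_t * (var_t ^ n * g)"
    proof -
      have "var_t\<^sup>2 * var_t ^ n dvd D var_t * (var_t ^ n * g)"
        using D2[of var_t] by (intro mult_dvd_mono) auto
      then show ?thesis by (simp add: power2_eq_square mult.assoc)
    qed
    ultimately show ?case by (metis dvd_add)
  qed (use D1 in simp)
  show ?thesis
  proof (induction k)
    case (Suc k)
    then obtain g where "(D ^^ k) f = var_t ^ k * g" by (auto simp: dvd_def)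
    then show ?case using step[of k g] by simp
  qed simp
qed

lemma chi_sums:
  assumes "D \<in> Der0"
  shows "(\<lambda>k. scalar (1 / fact k) * (D ^^ k) f) sums chi D f"
proof -
  define u where "u k = scalar (1 / fact k) * (D ^^ k) f" for k
  have u0: "fps_nth (u k) n = 0" if "n < k" for n k
  proof -
    have "var_t ^ k dvd u k"
      unfolding u_def using Der0_power[OF assms] by simp
    then show ?thesis using that by (auto simp: dvd_def var_t_def fps_X_power_mult_nth)
  qed
  define s where "s = Abs_fps (\<lambda>n. \<Sum>k\<le>n. fps_nth (u k) n)"
  have "(\<lambda>m. \<Sum>k<m. u k) \<longlonglongrightarrow> s"
  proof (rule tendsto_fpsI)
    fix n
    show "\<forall>\<^sub>F m in sequentially. fps_nth (\<Sum>k<m. u k) n = fps_nth s n"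
      unfolding eventually_sequentially
    proof (intro exI[of _ "Suc n"] allI impI)
      fix m assume "Suc n \<le> m"
      then have "(\<Sum>k<m. fps_nth (u k) n) = (\<Sum>k\<le>n. fps_nth (u k) n)"
        by (intro sum.mono_neutral_right) (auto simp: u0)
      then show "fps_nth (\<Sum>k<m. u k) n = fps_nth s n"
        by (simp add: s_def fps_sum_nth)
    qed
  qed
  then have "u sums s" by (simp add: sums_def)
  then have "u sums suminf u" by (rule sums_summable[THEN summable_sums])
  moreover have "suminf u = chi D f" by (simp add: chi_def u_def[abs_def])
  ultimately show ?thesis by (simp add: u_def[abs_def])
qed

end

theory Submission
  imports Defs "HOL-Computational_Algebra.Polynomial"
begin

unbundle fps_syntax

text \<open>
  Put \<open>N = \<phi> - id\<close>. Because \<open>\<rho> \<circ> \<phi> = \<rho>\<close> and \<open>\<phi>(t) = \<nu> t\<close> with \<open>\<nu>(x, 0) = 1\<close>, the linear map \<open>N\<close>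
  sends \<open>(t^k)\<close> into \<open>(t^(k+1))\<close> for every \<open>k\<close>. A formal power series \<open>F\<close> with complex coefficients
  can be evaluated at such an operator: \<open>F(N) = \<Sum>k. F\<^sub>k N^k\<close> converges \<open>t\<close>-adically. Evaluation turns
  products of series into composites of operators, and substitution of series into substitution
  of operators (lemmas \<open>opseries_mult\<close> and \<open>opseries_compose\<close>). As \<open>\<chi>\<^sub>D = exp(D)\<close>, the equation
  \<open>\<phi> = \<chi>\<^sub>D\<close> says \<open>N = (exp - 1)(D)\<close>. The series \<open>exp(z) - 1\<close> and \<open>ln(1 + z)\<close> are inverse to each other
  under substitution, so this equation has the single solution \<open>D = ln(1 + N)\<close> among all linear
  maps that raise the order in \<open>t\<close>. Elements of \<open>Der0\<close> are such maps, which gives uniqueness.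

  It remains to see that \<open>D = ln(1 + N)\<close> satisfies the Leibniz rule. As \<open>exp(z)^n = exp(n z)\<close>, the
  iterate \<open>\<phi>^n\<close> is \<open>exp(n D)\<close>, so each \<open>t\<close>-coefficient of \<open>\<phi>^n(f)\<close> is a polynomial in \<open>n\<close>, with
  constant term given by \<open>f\<close> and linear term given by \<open>D f\<close>. The identity
  \<open>\<phi>^n(f g) = \<phi>^n(f) \<phi>^n(g)\<close> holds for all natural \<open>n\<close> and is therefore an identity of polynomials;
  its linear term is the Leibniz rule.
\<close>

section \<open>Linear maps that raise the order in \<open>t\<close>\<close>

lemma var_t_power_dvd_iff: "var_t ^ k dvd f \<longleftrightarrow> (\<forall>i<k. f $ i = 0)"
proof
  assume "\<forall>i<k. f $ i = 0"
  then have "f = var_t ^ k * fps_shift k f"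
    by (intro fps_ext) (auto simp: var_t_def fps_X_power_mult_nth)
  then show "var_t ^ k dvd f" by (rule dvdI)
qed (auto simp: var_t_def fps_X_power_mult_nth)

lemma scalar_mult_nth: "(scalar c * f) $ m = fps_const c * f $ m"
  by (simp add: scalar_def)

definition t_raising :: "(fps_xt \<Rightarrow> fps_xt) \<Rightarrow> bool" where
  "t_raising N \<longleftrightarrow>
     (\<forall>f g. N (f + g) = N f + N g) \<and>
     (\<forall>c f. N (scalar c * f) = scalar c * N f) \<and>
     (\<forall>k f. var_t ^ k dvd f \<longrightarrow> var_t ^ Suc k dvd N f)"

lemma
  assumes "t_raising N"
  shows t_raising_add: "N (f + g) = N f + N g"
    and t_raising_scalar: "N (scalar c * f) = scalar c * N f"
    and t_raising_dvd: "var_t ^ k dvd f \<Longrightarrow> var_t ^ Suc k dvd N f"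
  using assms by (auto simp: t_raising_def)

lemma t_raising_power_add:
  "t_raising N \<Longrightarrow> (N ^^ k) (f + g) = (N ^^ k) f + (N ^^ k) g"
  by (induction k) (simp_all add: t_raising_add)

lemma t_raising_power_scalar:
  "t_raising N \<Longrightarrow> (N ^^ k) (scalar c * f) = scalar c * (N ^^ k) f"
  by (induction k) (simp_all add: t_raising_scalar)

lemma t_raising_power_diff:
  assumes "t_raising N"
  shows "(N ^^ k) (f - g) = (N ^^ k) f - (N ^^ k) g"
  using t_raising_power_add[OF assms, of k "f - g" g] by simp

lemma t_raising_power_sum:
  assumes "t_raising N"
  shows "(N ^^ k) (sum f A) = (\<Sum>i\<in>A. (N ^^ k) (f i))"
proof -
  have "(N ^^ k) 0 = 0" using t_raising_power_diff[OF assms, of k 0 0] by simp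
  then show ?thesis
    by (induction A rule: infinite_finite_induct) (simp_all add: t_raising_power_add[OF assms])
qed

lemma t_raising_power_dvd:
  "t_raising N \<Longrightarrow> var_t ^ j dvd f \<Longrightarrow> var_t ^ (j + k) dvd (N ^^ k) f"
  by (induction k) (use t_raising_dvd in \<open>auto simp del: power_Suc\<close>)

lemma t_raising_power_nth_0:
  assumes "t_raising N" "m < k"
  shows "(N ^^ k) f $ m = 0"
  using t_raising_power_dvd[OF assms(1), of 0 f k] assms(2) by (simp add: var_t_power_dvd_iff)

lemma t_raising_power_nth_cong:
  assumes "t_raising N" "\<And>i. i \<le> m \<Longrightarrow> f $ i = g $ i"
  shows "(N ^^ k) f $ m = (N ^^ k) g $ m"
proof -
  have "var_t ^ Suc m dvd f - g" using assms(2) by (simp add: var_t_power_dvd_iff del: power_Suc)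
  from t_raising_power_dvd[OF assms(1) this, of k]
  have "((N ^^ k) (f - g)) $ m = 0" by (simp add: var_t_power_dvd_iff del: power_Suc power_Suc2)
  then show ?thesis by (simp add: t_raising_power_diff[OF assms(1)])
qed


section \<open>Power series evaluated at an operator\<close>

text \<open>
  For \<open>N\<close> that raises the order in \<open>t\<close>, the image of \<open>N^k\<close> lies in \<open>(t^k)\<close>, so the terms with \<open>k > m\<close> of
  the series \<open>\<Sum>k. F\<^sub>k N^k f\<close> do not contribute to the coefficient of \<open>t^m\<close>.
\<close>

definition opseries :: "complex fps \<Rightarrow> (fps_xt \<Rightarrow> fps_xt) \<Rightarrow> fps_xt \<Rightarrow> fps_xt" where
  "opseries F N f = Abs_fps (\<lambda>m. \<Sum>k\<le>m. fps_const (F $ k) * (N ^^ k) f $ m)"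

lemma opseries_nth:
  assumes "t_raising N" "m \<le> M"
  shows "opseries F N f $ m = (\<Sum>k\<le>M. fps_const (F $ k) * (N ^^ k) f $ m)"
  unfolding opseries_def fps_nth_Abs_fps
  by (rule sum.mono_neutral_left) (use assms in \<open>auto simp: t_raising_power_nth_0\<close>)

lemma opseries_X_power:
  assumes "t_raising N"
  shows "opseries (fps_X ^ j) N f = (N ^^ j) f"
proof (rule fps_ext)
  fix m
  have "opseries (fps_X ^ j) N f $ m = (\<Sum>k\<le>max m j. fps_const ((fps_X ^ j) $ k) * (N ^^ k) f $ m)"
    by (rule opseries_nth[OF assms]) simp
  also have "\<dots> = (\<Sum>k\<le>max m j. if k = j then (N ^^ k) f $ m else 0)"
    by (rule sum.cong) auto
  finally show "opseries (fps_X ^ j) N f $ m = (N ^^ j) f $ m" by simp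
qed

lemma opseries_1: "t_raising N \<Longrightarrow> opseries 1 N f = f"
  using opseries_X_power[of N 0 f] by simp

lemma opseries_X: "t_raising N \<Longrightarrow> opseries fps_X N f = N f"
  using opseries_X_power[of N 1 f] by simp

lemma fps_const_sum: "fps_const (sum a A) = (\<Sum>i\<in>A. fps_const (a i :: 'a :: comm_monoid_add))"
  by (induction A rule: infinite_finite_induct) (simp_all flip: fps_const_add)

lemma opseries_diff: "opseries (F - H) N f = opseries F N f - opseries H N f"
  by (rule fps_ext)
     (simp add: opseries_def sum_subtractf algebra_simps flip: fps_const_sub)

text \<open>
  Both sides reduce to the finite sum of \<open>F\<^sub>k H\<^sub>j (N^(k+j) f)\<^sub>m\<close>: over the square \<open>k, j \<le> m\<close> for the
  composite, and over the triangle \<open>k + j \<le> m\<close> for the product. The terms outside the triangle vanish.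
  The inner series may be truncated first because \<open>N^k\<close> does not lower the order of the remainder.
\<close>

lemma opseries_mult:
  assumes "t_raising N"
  shows "opseries (F * H) N f = opseries F N (opseries H N f)"
proof (rule fps_ext)
  fix m
  have inner: "(N ^^ k) (opseries H N f) $ m = (\<Sum>j\<le>m. fps_const (H $ j) * (N ^^ (k + j)) f $ m)"
    for k
  proof -
    have "(N ^^ k) (opseries H N f) $ m = (N ^^ k) (\<Sum>j\<le>m. scalar (H $ j) * (N ^^ j) f) $ m"
      by (rule t_raising_power_nth_cong[OF assms])
         (simp add: opseries_nth[OF assms] fps_sum_nth scalar_mult_nth)
    then show ?thesis
      by (simp add: t_raising_power_sum[OF assms] t_raising_power_scalar[OF assms] fps_sum_nth
          scalar_mult_nth funpow_add)
  qed
  define g where "g k j = fps_const (F $ k) * (fps_const (H $ j) * (N ^^ (k + j)) f $ m)" for k j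
  have g_0: "g k j = 0" if "m < k + j" for k j
    using that by (simp add: g_def t_raising_power_nth_0[OF assms])
  have "opseries F N (opseries H N f) $ m = (\<Sum>k\<le>m. \<Sum>j\<le>m. g k j)"
    by (simp add: opseries_nth[OF assms order_refl] inner g_def sum_distrib_left)
  also have "\<dots> = (\<Sum>(k, j)\<in>{..m} \<times> {..m}. g k j)"
    by (simp add: sum.cartesian_product)
  also have "\<dots> = (\<Sum>(k, j)\<in>{(k, j). k + j \<le> m}. g k j)"
    by (rule sum.mono_neutral_right) (auto intro: g_0)
  also have "\<dots> = (\<Sum>n\<le>m. \<Sum>k\<le>n. g k (n - k))"
    by (rule sum.triangle_reindex_eq)
  also have "\<dots> = (\<Sum>n\<le>m. fps_const ((F * H) $ n) * (N ^^ n) f $ m)"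
    by (rule sum.cong[OF refl])
       (simp add: g_def fps_mult_nth fps_const_sum sum_distrib_right atLeast0AtMost mult.assoc
         flip: fps_const_mult)
  finally show "opseries (F * H) N f $ m = opseries F N (opseries H N f) $ m"
    by (simp add: opseries_nth[OF assms order_refl])
qed

lemma opseries_power:
  assumes "t_raising N"
  shows "opseries (F ^ k) N f = (opseries F N ^^ k) f"
  by (induction k) (simp_all add: opseries_1 opseries_mult assms)

lemma t_raising_opseries:
  assumes N: "t_raising N" and "F $ 0 = 0"
  shows "t_raising (opseries F N)"
  unfolding t_raising_def
proof (intro conjI allI impI)
  fix f g c k
  show "opseries F N (f + g) = opseries F N f + opseries F N g"
    by (rule fps_ext)
       (simp add: opseries_def t_raising_power_add[OF N] sum.distrib distrib_left)
  show "opseries F N (scalar c * f) = scalar c * opseries F N f"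
    by (rule fps_ext)
       (simp add: opseries_def t_raising_power_scalar[OF N] scalar_mult_nth sum_distrib_left
         mult.left_commute)
  assume f: "var_t ^ k dvd f"
  have "fps_const (F $ j) * (N ^^ j) f $ i = 0" if "i < Suc k" for i j
  proof (cases "j = 0")
    case False
    have "i < k + j" using that False by simp
    then have "(N ^^ j) f $ i = 0"
      using t_raising_power_dvd[OF N f, of j] by (simp add: var_t_power_dvd_iff)
    then show ?thesis by simp
  qed (simp add: assms(2))
  then have "opseries F N f $ i = 0" if "i < Suc k" for i
    unfolding opseries_def fps_nth_Abs_fps using that by (intro sum.neutral) blast
  then show "var_t ^ Suc k dvd opseries F N f"
    by (simp add: var_t_power_dvd_iff del: power_Suc)
qed

text \<open>
  By multiplicativity the iterates of \<open>H(N)\<close> are \<open>H^k(N)\<close>; what remains is the interchange of two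
  finite sums.
\<close>

lemma opseries_compose:
  assumes N: "t_raising N" and H: "H $ 0 = 0"
  shows "opseries (F oo H) N f = opseries F (opseries H N) f"
proof (rule fps_ext)
  fix m
  have "(F oo H) $ j = (\<Sum>k\<le>m. F $ k * (H ^ k) $ j)" if "j \<le> m" for j
    unfolding fps_compose_nth
    by (rule sum.mono_neutral_left) (use that startsby_zero_power_prefix[OF H] in auto)
  then have "opseries (F oo H) N f $ m
      = (\<Sum>j\<le>m. \<Sum>k\<le>m. fps_const (F $ k) * (fps_const ((H ^ k) $ j) * (N ^^ j) f $ m))"
    by (simp add: opseries_nth[OF N order_refl] fps_const_sum sum_distrib_right mult.assoc
        flip: fps_const_mult)
  also have "\<dots> = (\<Sum>k\<le>m. fps_const (F $ k) * opseries (H ^ k) N f $ m)"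
    by (subst sum.swap) (simp add: opseries_nth[OF N order_refl] sum_distrib_left)
  also have "\<dots> = opseries F (opseries H N) f $ m"
    by (simp add: opseries_power[OF N] opseries_nth[OF t_raising_opseries[where F = H, OF N H] order_refl])
  finally show "opseries (F oo H) N f $ m = opseries F (opseries H N) f $ m" .
qed


section \<open>Exponential and logarithm\<close>

text \<open>
  Membership in \<open>Der0\<close> bounds the image under \<open>D\<close> of the whole ring and of \<open>(t)\<close>; the Leibniz rule for \<open>t \<cdot> (t^k g)\<close> propagates
  the gain of one power of \<open>t\<close> to all \<open>(t^k)\<close>.
\<close>

lemma Der0_imp_t_raising:
  assumes "D \<in> Der0"
  shows "t_raising D"
proof -
  have add: "D (f + g) = D f + D g"
    and scal: "D (scalar c * f) = scalar c * D f"
    and leibniz: "D (f * g) = f * D g + D f * g"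
    and D1: "var_t dvd D f"
    and D2: "var_t dvd f \<Longrightarrow> var_t\<^sup>2 dvd D f" for f g c
    using assms by (auto simp: Der0_def derivation_def principal_ideal_def image_subset_iff)
  have step: "var_t ^ Suc k dvd D (var_t ^ k * g)" for k g
  proof (induction k)
    case 0
    show ?case using D1 by simp
  next
    case (Suc k)
    have "var_t * var_t ^ Suc k dvd var_t * D (var_t ^ k * g)"
      using Suc by (rule mult_dvd_mono[OF dvd_refl])
    moreover have "var_t\<^sup>2 * var_t ^ k dvd D var_t * (var_t ^ k * g)"
      using D2[OF dvd_refl] by (rule mult_dvd_mono) (rule dvd_triv_left)
    moreover have "var_t\<^sup>2 * var_t ^ k = var_t ^ Suc (Suc k)" "var_t * var_t ^ Suc k = var_t ^ Suc (Suc k)"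
      by (simp_all only: power2_eq_square power_Suc mult.assoc)
    moreover have "D (var_t ^ Suc k * g) = var_t * D (var_t ^ k * g) + D var_t * (var_t ^ k * g)"
      using leibniz[of var_t "var_t ^ k * g"] by (simp only: power_Suc mult.assoc)
    ultimately show ?case by (simp only: dvd_add)
  qed
  have "var_t ^ Suc k dvd D f" if "var_t ^ k dvd f" for k f
  proof -
    from that obtain g where "f = var_t ^ k * g" by (rule dvdE)
    then show ?thesis using step[of k g] by (simp only:)
  qed
  then show ?thesis
    unfolding t_raising_def using add scal by blast
qed

lemma chi_eq_opseries:
  assumes "t_raising D"
  shows "chi D f = opseries (fps_exp 1) D f"
proof -
  have "(\<lambda>n. \<Sum>k<n. scalar (1 / fact k) * (D ^^ k) f) \<longlonglongrightarrow> opseries (fps_exp 1) D f"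
  proof (rule tendsto_fpsI)
    fix m
    have "(\<Sum>k<n. scalar (1 / fact k) * (D ^^ k) f) $ m = opseries (fps_exp 1) D f $ m"
      if "Suc m \<le> n" for n
    proof -
      from \<open>Suc m \<le> n\<close> obtain M where M: "n = Suc M" "m \<le> M" by (cases n) auto
      show ?thesis
        by (simp add: opseries_nth[OF assms M(2)] fps_sum_nth scalar_mult_nth M(1)
            lessThan_Suc_atMost del: sum.lessThan_Suc)
    qed
    then show "\<forall>\<^sub>F n in sequentially.
        (\<Sum>k<n. scalar (1 / fact k) * (D ^^ k) f) $ m = opseries (fps_exp 1) D f $ m"
      unfolding eventually_sequentially by blast
  qed
  then show ?thesis
    unfolding chi_def by (intro sums_unique[symmetric]) (simp add: sums_def)
qed

lemma chi_minus_id: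
  assumes "t_raising D"
  shows "chi D f - f = opseries (fps_exp 1 - 1) D f"
  by (simp add: chi_eq_opseries opseries_diff opseries_1 assms)

lemma opseries_ln_chi:
  assumes "t_raising D"
  shows "opseries (fps_ln 1) (\<lambda>f. chi D f - f) = D"
proof
  fix f
  have "opseries (fps_ln 1) (\<lambda>f. chi D f - f) f = opseries (fps_ln 1 oo (fps_exp 1 - 1)) D f"
    by (simp add: chi_minus_id[OF assms] opseries_compose[OF assms])
  also have "\<dots> = D f"
    by (simp add: fps_ln_fps_exp_inv fps_inv_fps_exp_compose opseries_X[OF assms])
  finally show "opseries (fps_ln 1) (\<lambda>f. chi D f - f) f = D f" .
qed

lemma chi_opseries_ln:
  assumes "t_raising N"
  shows "chi (opseries (fps_ln 1) N) f = f + N f"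
proof -
  have "chi (opseries (fps_ln 1) N) f - f = opseries ((fps_exp 1 - 1) oo fps_ln 1) N f"
    by (simp add: chi_minus_id t_raising_opseries opseries_compose assms)
  also have "\<dots> = N f"
    by (simp add: fps_ln_fps_exp_inv fps_inv_fps_exp_compose opseries_X[OF assms])
  finally show ?thesis by (simp add: algebra_simps)
qed


section \<open>The Leibniz rule\<close>

text \<open>
  The \<open>t^m\<close>-coefficient of \<open>exp(s D) f\<close> as a polynomial in the time \<open>s\<close> over the ring of power series in \<open>x\<close>.
\<close>

definition flow_poly :: "(fps_xt \<Rightarrow> fps_xt) \<Rightarrow> fps_xt \<Rightarrow> nat \<Rightarrow> fps_x poly" where
  "flow_poly D f m = (\<Sum>k\<le>m. monom (fps_const (1 / fact k) * (D ^^ k) f $ m) k)"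

lemma coeff_flow_poly:
  assumes "t_raising D"
  shows "coeff (flow_poly D f m) k = fps_const (1 / fact k) * (D ^^ k) f $ m"
  using t_raising_power_nth_0[OF assms, of m k f]
  by (auto simp: flow_poly_def coeff_sum coeff_monom)

lemma poly_flow_poly:
  assumes "t_raising D"
  shows "poly (flow_poly D f m) (of_nat n) = (chi D ^^ n) f $ m"
proof -
  have "chi D = opseries (fps_exp 1) D" by (rule ext) (rule chi_eq_opseries[OF assms])
  then have "(chi D ^^ n) f = opseries (fps_exp (of_nat n)) D f"
    by (simp add: fps_exp_power_mult flip: opseries_power[OF assms])
  then have "(chi D ^^ n) f $ m = (\<Sum>k\<le>m. fps_const (fps_exp (of_nat n) $ k) * (D ^^ k) f $ m)"
    by (simp add: opseries_def del: fps_exp_nth)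
  moreover have "fps_const (fps_exp (of_nat n) $ k) = fps_const (1 / fact k :: complex) * of_nat n ^ k"
    for k
    by (simp only: fps_exp_nth fps_of_nat[symmetric] fps_const_power fps_const_mult of_nat_fact
        times_divide_eq_left mult_1)
  ultimately have "(chi D ^^ n) f $ m
      = (\<Sum>k\<le>m. fps_const (1 / fact k) * of_nat n ^ k * (D ^^ k) f $ m)"
    by (simp only:)
  also have "\<dots> = (\<Sum>k\<le>m. fps_const (1 / fact k) * (D ^^ k) f $ m * of_nat n ^ k)"
    by (simp only: mult_ac)
  finally show ?thesis
    by (simp only: flow_poly_def poly_sum poly_monom)
qed

text \<open>
  The ring of power series in \<open>x\<close> is an integral domain of characteristic \<open>0\<close>, so a polynomial over
  it is determined by its values at the natural numbers.
\<close>

lemma poly_eqI_of_nat: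
  fixes p q :: "'a :: {idom, semiring_char_0} poly"
  assumes "\<And>n. poly p (of_nat n) = poly q (of_nat n)"
  shows "p = q"
proof (rule ccontr)
  assume "p \<noteq> q"
  then have "finite {x. poly (p - q) x = 0}" by (intro poly_roots_finite) simp
  moreover have "range of_nat \<subseteq> {x. poly (p - q) x = 0}" using assms by auto
  ultimately have "finite (range (of_nat :: nat \<Rightarrow> 'a))" by (rule finite_subset[rotated])
  then show False by (simp add: finite_image_iff inj_of_nat)
qed

text \<open>
  Iterating multiplicativity of \<open>exp(D)\<close> gives it for \<open>exp(n D)\<close> with \<open>n\<close> natural, hence for \<open>exp(s D)\<close>
  with \<open>s\<close> an indeterminate. The Leibniz rule is its derivative at \<open>s = 0\<close>, read off as the coefficient
  of \<open>s\<close>.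
\<close>

lemma leibniz_if_chi_mult:
  assumes D: "t_raising D" and mult: "\<And>f g. chi D (f * g) = chi D f * chi D g"
  shows "D (f * g) = f * D g + D f * g"
proof (rule fps_ext)
  fix m
  have "(chi D ^^ n) (f * g) = (chi D ^^ n) f * (chi D ^^ n) g" for n
    by (induction n) (simp_all add: mult)
  then have "flow_poly D (f * g) m = (\<Sum>i\<le>m. flow_poly D f i * flow_poly D g (m - i))"
    by (intro poly_eqI_of_nat)
       (simp add: poly_flow_poly[OF D] poly_sum fps_mult_nth atLeast0AtMost)
  then have "coeff (flow_poly D (f * g) m) 1
      = coeff (\<Sum>i\<le>m. flow_poly D f i * flow_poly D g (m - i)) 1"
    by simp
  then show "D (f * g) $ m = (f * D g + D f * g) $ m"
    by (simp add: coeff_sum coeff_mult coeff_flow_poly[OF D] fps_mult_nth atLeast0AtMost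
        sum.distrib)
qed

lemma Der0_if_chi_mult:
  assumes D: "t_raising D" and "\<And>f g. chi D (f * g) = chi D f * chi D g"
  shows "D \<in> Der0"
proof -
  have "derivation D"
    unfolding derivation_def
    using t_raising_add[OF D] t_raising_scalar[OF D] leibniz_if_chi_mult[OF assms] by blast
  moreover have "var_t dvd D f" for f
    using t_raising_dvd[OF D, of 0 f] by simp
  moreover have "var_t\<^sup>2 dvd D f" if "var_t dvd f" for f
    using t_raising_dvd[OF D, of 1 f] that by (simp add: power2_eq_square)
  ultimately show ?thesis
    unfolding Der0_def principal_ideal_def by auto
qed


section \<open>Automorphisms tangent to the identity\<close>

text \<open>
  One has \<open>\<phi>(t^k g) - t^k g = t^k (\<nu>^k \<phi>(g) - g)\<close>, and the second factor vanishes at \<open>t = 0\<close> because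
  \<open>\<nu>(x, 0) = 1\<close> and \<open>\<rho> \<circ> \<phi> = \<rho>\<close>.
\<close>

lemma G0_minus_id_t_raising:
  assumes "\<phi> \<in> G0"
  shows "t_raising (\<lambda>f. \<phi> f - f)"
proof -
  have G: "\<phi> \<in> G" and nu1: "rho (nu \<phi>) = 1" using assms by (auto simp: G0_def)
  have add: "\<phi> (f + g) = \<phi> f + \<phi> g" and mult: "\<phi> (f * g) = \<phi> f * \<phi> g"
    and scal: "\<phi> (scalar c) = scalar c" and rho: "rho (\<phi> f) = rho f" for f g c
    using G by (auto simp: G_def algebra_automorphism_def fun_eq_iff)
  have nu: "\<phi> var_t = nu \<phi> * var_t"
    using theI'[OF nu_ex1[OF G]] by (simp add: nu_def)
  have "scalar 1 = 1" by (simp add: scalar_def)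
  then have one: "\<phi> 1 = 1" using scal[of 1] by simp
  have pow: "\<phi> (var_t ^ k) = var_t ^ k * nu \<phi> ^ k" for k
    by (induction k) (simp_all add: one mult nu mult_ac)
  have step: "var_t ^ Suc k dvd \<phi> (var_t ^ k * g) - var_t ^ k * g" for k g
  proof -
    have "rho (nu \<phi> ^ k * \<phi> g - g) = 0"
      using nu1 rho[of g] by (simp add: rho_def fps_nth_power_0)
    then have "var_t ^ k * var_t dvd var_t ^ k * (nu \<phi> ^ k * \<phi> g - g)"
      by (intro mult_dvd_mono) (simp_all add: rho_eq_0_iff)
    then show ?thesis by (simp add: mult pow algebra_simps)
  qed
  have "var_t ^ Suc k dvd \<phi> f - f" if "var_t ^ k dvd f" for k f
    using that step by (elim dvdE) metis
  then show ?thesis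
    unfolding t_raising_def by (simp add: add mult scal algebra_simps)
qed

theorem mainTheorem4:
  fixes \<phi> :: "fps_xt \<Rightarrow> fps_xt"
  assumes "\<phi> \<in> G0"
  shows "\<exists>!D. D \<in> Der0 \<and> \<phi> = chi D"
proof (rule ex1I)
  let ?N = "\<lambda>f. \<phi> f - f"
  let ?D = "opseries (fps_ln 1) ?N"
  have N: "t_raising ?N" by (rule G0_minus_id_t_raising[OF assms])
  have chi: "\<phi> = chi ?D" by (rule ext) (simp add: chi_opseries_ln[OF N])
  have "\<phi> (f * g) = \<phi> f * \<phi> g" for f g
    using assms by (simp add: G0_def G_def algebra_automorphism_def)
  then have "?D \<in> Der0"
    using chi by (intro Der0_if_chi_mult t_raising_opseries[OF N]) simp_all
  with chi show "?D \<in> Der0 \<and> \<phi> = chi ?D" by blast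
  fix D assume "D \<in> Der0 \<and> \<phi> = chi D"
  then show "D = ?D" using opseries_ln_chi[OF Der0_imp_t_raising] by simp
qed

end
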